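(* Let $\ell \geq 1$ be an integer, let $G$ be a graph on $n$ vertices, let $(L,H,R)$ be an excellent partition of $V(G)$, and let $(I,O)$ be a partition of $H \cup R$. If at most $\frac{|L|}{10}$ vertices in $R$ have degree less than $10\ell$ in $G$, then there are at most $2^{|L|}\cdot 2^{-\frac{|L|}{10}}$ minimal $(I,O)$-extensions. Further, the family of all minimal $(I,O)$-extensions can be enumerated in time $2^{|L|}\cdot 2^{-\frac{|L|}{10}}\cdot n^{\mathcal{O}(1)}$.
   Context: All graphs are finite and simple. For the fixed integer $\ell$, a partition $(L,H,R)$ of $V(G)$ is a good partition if $|L| \geq 10|H|$, $L$ is an independent set, and every vertex of $L$ has fewer than $\ell$ neighbors in $R$; it is an excellent partition if moreover $G[H \cup R]$ has no edges. A vertex set $X$ is a connected dominating set of $G$ if every vertex not in $X$ has a neighbor in $X$ and $G[X]$ is connected. For disjoint vertex sets $I$ and $O$, an $(I,O)$-extension is a vertex set $S$ disjoint from $I \cup O$ such that $I \cup S$ is a connected dominating set of $G$; it is minimal if no proper subset of it is also an $(I,O)$-extension. *)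

theory Defs
  imports Complex_Main "Graph_Theory.Graph_Theory"
begin

section \<open>Graphs, partitions and extensions\<close>

text \<open>
  A finite simple graph is a \<^term>\<open>G\<close> with \<^term>\<open>pair_graph G\<close>: finite, loop-free, with a
  symmetric arc set, so an edge \<open>uv\<close> is the pair of arcs \<open>(u, v)\<close>, \<open>(v, u)\<close>.
\<close>

definition neighbors :: "'a pair_pre_digraph \<Rightarrow> 'a \<Rightarrow> 'a set" where
  "neighbors G v = {w. (v, w) \<in> parcs G}"

definition degree :: "'a pair_pre_digraph \<Rightarrow> 'a \<Rightarrow> nat" where
  "degree G v = card (neighbors G v)"

definition independent_set :: "'a pair_pre_digraph \<Rightarrow> 'a set \<Rightarrow> bool" where
  "independent_set G X \<longleftrightarrow> X \<subseteq> pverts G \<and> (\<forall>u\<in>X. \<forall>v\<in>X. (u, v) \<notin> parcs G)"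

definition good_partition ::
  "nat \<Rightarrow> 'a pair_pre_digraph \<Rightarrow> 'a set \<Rightarrow> 'a set \<Rightarrow> 'a set \<Rightarrow> bool" where
  "good_partition l G L H R \<longleftrightarrow>
     L \<union> H \<union> R = pverts G \<and> L \<inter> H = {} \<and> L \<inter> R = {} \<and> H \<inter> R = {} \<and>
     card L \<ge> 10 * card H \<and>
     independent_set G L \<and>
     (\<forall>v\<in>L. card (neighbors G v \<inter> R) < l)"

definition excellent_partition ::
  "nat \<Rightarrow> 'a pair_pre_digraph \<Rightarrow> 'a set \<Rightarrow> 'a set \<Rightarrow> 'a set \<Rightarrow> bool" where
  "excellent_partition l G L H R \<longleftrightarrow>
     good_partition l G L H R \<and> arcs (with_proj G \<restriction> (H \<union> R)) = {}"

text \<open>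
  The library's notion of connectedness excludes the empty graph; here this matters only if
  \<^term>\<open>G\<close> itself has no vertices.
\<close>

definition connected_dominating_set :: "'a pair_pre_digraph \<Rightarrow> 'a set \<Rightarrow> bool" where
  "connected_dominating_set G X \<longleftrightarrow>
     X \<subseteq> pverts G \<and>
     (\<forall>v \<in> pverts G - X. neighbors G v \<inter> X \<noteq> {}) \<and>
     Digraph_Component.connected (with_proj G \<restriction> X)"

definition extension :: "'a pair_pre_digraph \<Rightarrow> 'a set \<Rightarrow> 'a set \<Rightarrow> 'a set \<Rightarrow> bool" where
  "extension G In Out S \<longleftrightarrow>
     S \<subseteq> pverts G \<and> S \<inter> (In \<union> Out) = {} \<and> connected_dominating_set G (In \<union> S)"

definition minimal_extension :: "'a pair_pre_digraph \<Rightarrow> 'a set \<Rightarrow> 'a set \<Rightarrow> 'a set \<Rightarrow> bool" where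
  "minimal_extension G In Out S \<longleftrightarrow>
     extension G In Out S \<and> (\<forall>S'. S' \<subset> S \<longrightarrow> \<not> extension G In Out S')"


section \<open>Computation model\<close>

text \<open>
  Programs of pure first-order LISP, evaluated call by value on binary trees; the running time is
  the number of evaluation steps. Every step is a constant number of pointer operations, so a
  random access machine simulates it in constant time (time logarithmic in the running time,
  under logarithmic cost), and conversely a random access machine running for \<open>T\<close> steps is
  simulated with an overhead polynomial in \<open>log T\<close>. Hence a bound \<open>2^(9|L|/10) n^O(1)\<close>
  means the same in both models.

  A program is the list of its function bodies: \<open>App f es\<close> calls the \<open>f\<close>-th one, in which
  \<open>Var i\<close> refers to the \<open>i\<close>-th argument. Evaluation is stuck on an unbound variable, an
  undefined function and the \<open>FstE\<close> or \<open>SndE\<close> of a leaf.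
\<close>

datatype btree = Leaf | Node btree btree

datatype expr =
    Var nat
  | NilE
  | PairE expr expr
  | FstE expr
  | SndE expr
  | IfE expr expr expr
  | App nat "expr list"

type_synonym program = "expr list"

inductive
  evalto :: "program \<Rightarrow> btree list \<Rightarrow> expr \<Rightarrow> btree \<Rightarrow> nat \<Rightarrow> bool" and
  evalsto :: "program \<Rightarrow> btree list \<Rightarrow> expr list \<Rightarrow> btree list \<Rightarrow> nat \<Rightarrow> bool"
  for P :: program
where
  evalto_Var: "i < length env \<Longrightarrow> evalto P env (Var i) (env ! i) 1"
| evalto_Nil: "evalto P env NilE Leaf 1"
| evalto_Pair: "evalto P env e1 x s \<Longrightarrow> evalto P env e2 y t \<Longrightarrow>
    evalto P env (PairE e1 e2) (Node x y) (s + t + 1)"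
| evalto_Fst: "evalto P env e (Node x y) t \<Longrightarrow> evalto P env (FstE e) x (t + 1)"
| evalto_Snd: "evalto P env e (Node x y) t \<Longrightarrow> evalto P env (SndE e) y (t + 1)"
| evalto_If_Node: "evalto P env e (Node x y) s \<Longrightarrow> evalto P env e1 z t \<Longrightarrow>
    evalto P env (IfE e e1 e2) z (s + t + 1)"
| evalto_If_Leaf: "evalto P env e Leaf s \<Longrightarrow> evalto P env e2 z t \<Longrightarrow>
    evalto P env (IfE e e1 e2) z (s + t + 1)"
| evalto_App: "f < length P \<Longrightarrow> evalsto P env es xs s \<Longrightarrow> evalto P xs (P ! f) z t \<Longrightarrow>
    evalto P env (App f es) z (s + t + 1)"
| evalsto_Nil: "evalsto P env [] [] 0"
| evalsto_Cons: "evalto P env e x s \<Longrightarrow> evalsto P env es xs t \<Longrightarrow>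
    evalsto P env (e # es) (x # xs) (s + t)"

lemma evalto_deterministic:
  "evalto P env e x s \<Longrightarrow> evalto P env e y t \<Longrightarrow> x = y \<and> s = t"
  "evalsto P env es xs s \<Longrightarrow> evalsto P env es ys t \<Longrightarrow> xs = ys \<and> s = t"
proof (induction arbitrary: y t and ys t rule: evalto_evalsto.inducts)
  case (evalto_Var i env)
  then show ?case by (auto elim: evalto.cases)
next
  case (evalto_Nil env)
  then show ?case by (auto elim: evalto.cases)
next
  case (evalto_Pair env e1 x s e2 y t)
  from evalto_Pair.prems show ?case
    by cases (use evalto_Pair.IH in blast)
next
  case (evalto_Fst env e x y t)
  from evalto_Fst.prems show ?case
    by cases (use evalto_Fst.IH in blast)
next
  case (evalto_Snd env e x y t)
  from evalto_Snd.prems show ?case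
    by cases (use evalto_Snd.IH in blast)
next
  case (evalto_If_Node env e x y s e1 z t e2)
  from evalto_If_Node.prems show ?case
    by cases (use evalto_If_Node.IH in blast)+
next
  case (evalto_If_Leaf env e s e2 z t e1)
  from evalto_If_Leaf.prems show ?case
    by cases (use evalto_If_Leaf.IH in blast)+
next
  case (evalto_App f env es xs s z t)
  from evalto_App.prems show ?case
    by cases (use evalto_App.IH in blast)
next
  case (evalsto_Nil env)
  then show ?case by (auto elim: evalsto.cases)
next
  case (evalsto_Cons env e x s es xs t)
  from evalsto_Cons.prems show ?case
    by cases (use evalsto_Cons.IH in blast)
qed

definition computes_in_time :: "program \<Rightarrow> btree \<Rightarrow> btree \<Rightarrow> nat \<Rightarrow> bool" where
  "computes_in_time P x y t \<longleftrightarrow> evalto P [x] (App 0 [Var 0]) y t"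

text \<open>
  A graph with vertex set \<open>{0, \<dots>, n - 1}\<close> is passed as its adjacency matrix, and a set of
  vertices as its characteristic bit vector of length \<open>n\<close>.
\<close>

primrec enc_list :: "btree list \<Rightarrow> btree" where
  "enc_list [] = Leaf"
| "enc_list (x # xs) = Node x (enc_list xs)"

definition enc_bool :: "bool \<Rightarrow> btree" where
  "enc_bool b = (if b then Node Leaf Leaf else Leaf)"

definition enc_set :: "nat \<Rightarrow> nat set \<Rightarrow> btree" where
  "enc_set n X = enc_list (map (\<lambda>v. enc_bool (v \<in> X)) [0..<n])"

definition enc_graph :: "nat \<Rightarrow> nat pair_pre_digraph \<Rightarrow> btree" where
  "enc_graph n G = enc_list (map (\<lambda>v. enc_set n (neighbors G v)) [0..<n])"

definition enc_instance ::
  "nat \<Rightarrow> nat pair_pre_digraph \<Rightarrow> nat set \<Rightarrow> nat set \<Rightarrow> nat set \<Rightarrow> nat set \<Rightarrow> nat set \<Rightarrow> btree" where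
  "enc_instance n G L H R In Out =
     enc_list (enc_graph n G # map (enc_set n) [L, H, R, In, Out])"

text \<open>The members of the family are listed in arbitrary order, each exactly once.\<close>

definition enumerates_in_time :: "program \<Rightarrow> nat \<Rightarrow> btree \<Rightarrow> nat set set \<Rightarrow> nat \<Rightarrow> bool" where
  "enumerates_in_time P n x F t \<longleftrightarrow>
     (\<exists>Ss. distinct Ss \<and> set Ss = F \<and>
        computes_in_time P x (enc_list (map (enc_set n) Ss)) t)"

end

theory Submission
  imports Defs
begin

text \<open>
  The graph is bipartite with sides \<open>L\<close> and \<open>H \<union> R\<close>. Counting the edges between \<open>L\<close> and \<open>R\<close> shows
  that at most \<open>|L|/10\<close> vertices of \<open>R\<close> have degree at least \<open>10 l\<close>, so \<open>|H \<union> R| \<le> 3|L|/10\<close>. A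
  minimal extension \<open>S\<close> is contained in \<open>L\<close>; fewer than \<open>|In|\<close> of its vertices connect \<open>In\<close>, and at
  most \<open>|Out|\<close> further ones dominate \<open>Out\<close>, while \<open>In\<close> dominates \<open>L\<close>. Hence \<open>|S| \<le> |H \<union> R|\<close>,
  apart from the one-vertex graph. The number of subsets of \<open>L\<close> of size at most \<open>k\<close> is bounded by
  \<open>2 ^ k (3/2) ^ |L|\<close>, which for \<open>k = 3|L|/10\<close> is at most \<open>2 ^ (9|L|/10)\<close>. The program lists these
  subsets and keeps the minimal extensions; as extensions are closed under adding vertices of \<open>L\<close>,
  minimality is tested by deleting single vertices.
\<close>

subsection \<open>Connected vertex sets\<close>

lemma independent_set_subset: "independent_set G X \<Longrightarrow> Y \<subseteq> X \<Longrightarrow> independent_set G Y"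
  by (auto simp: independent_set_def)

abbreviation (in pair_pre_digraph) induces_connected :: "'a set \<Rightarrow> bool" where
  "induces_connected X \<equiv> Digraph_Component.connected (with_proj G \<restriction> X)"

context pair_sym_digraph
begin

lemma induces_connected_iff_crossing_arc:
  "induces_connected X \<longleftrightarrow>
    X \<noteq> {} \<and> (\<forall>A. A \<noteq> {} \<and> A \<subset> X \<longrightarrow> (\<exists>u\<in>A. \<exists>v\<in>X - A. (u, v) \<in> parcs G))"
proof -
  define E where "E = parcs G \<inter> X \<times> X"
  have "(arcs_ends (with_proj G \<restriction> X))\<^sup>s = E"
    by (auto simp: E_def symcl_def arcs_ends_conv dest: arcs_symmetric)
  then have connected_iff: "induces_connected X \<longleftrightarrow>
    X \<noteq> {} \<and> (\<forall>u\<in>X. \<forall>v\<in>X. (u, v) \<in> rtrancl_on X E)"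
    by (simp add: connected_conv)
  have "\<exists>u\<in>A. \<exists>v\<in>X - A. (u, v) \<in> parcs G"
    if reach: "\<forall>u\<in>X. \<forall>v\<in>X. (u, v) \<in> rtrancl_on X E" and A: "A \<noteq> {}" "A \<subset> X" for A
  proof (rule ccontr)
    assume no_crossing: "\<not> (\<exists>u\<in>A. \<exists>v\<in>X - A. (u, v) \<in> parcs G)"
    obtain a b where ab: "a \<in> A" "b \<in> X" "b \<notin> A" using A by blast
    then have "(a, b) \<in> rtrancl_on X E" using reach A by blast
    then have "b \<in> A"
      by (induction rule: rtrancl_on_induct) (use ab no_crossing in \<open>auto simp: E_def\<close>)
    with ab show False by simp
  qed
  moreover have "(u, v) \<in> rtrancl_on X E"
    if crossing: "\<forall>A. A \<noteq> {} \<and> A \<subset> X \<longrightarrow> (\<exists>u\<in>A. \<exists>v\<in>X - A. (u, v) \<in> parcs G)"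
      and uv: "u \<in> X" "v \<in> X" for u v
  proof -
    define A where "A = {w \<in> X. (u, w) \<in> rtrancl_on X E}"
    have "w \<in> A" if "z \<in> A" "w \<in> X" "(z, w) \<in> parcs G" for z w
      using that by (auto simp: A_def E_def intro: rtrancl_on_into_rtrancl_on)
    then have "\<not> (A \<noteq> {} \<and> A \<subset> X)" using crossing by blast
    moreover have "u \<in> A" using uv by (simp add: A_def)
    ultimately have "A = X" by (auto simp: A_def)
    then show ?thesis using uv by (auto simp: A_def)
  qed
  ultimately show ?thesis unfolding connected_iff by blast
qed

lemma induces_connected_crossing_arc:
  assumes "induces_connected X" "A \<noteq> {}" "A \<subseteq> X" "A \<noteq> X"
  obtains u v where "u \<in> A" "v \<in> X - A" "(u, v) \<in> parcs G"
  using assms unfolding induces_connected_iff_crossing_arc by blast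

lemma induces_connected_singleton: "induces_connected {x}"
  by (auto simp: induces_connected_iff_crossing_arc)

lemma induces_connected_superset:
  assumes Y: "induces_connected Y" "Y \<subseteq> Z"
    and attached: "\<And>z. z \<in> Z - Y \<Longrightarrow> \<exists>y\<in>Y. (z, y) \<in> parcs G"
  shows "induces_connected Z"
  unfolding induces_connected_iff_crossing_arc
proof (intro conjI allI impI)
  show "Z \<noteq> {}" using Y by (auto simp: induces_connected_iff_crossing_arc)
next
  fix A assume A: "A \<noteq> {} \<and> A \<subset> Z"
  consider (disjoint) "A \<inter> Y = {}" | (contains) "Y \<subseteq> A" |
    (splits) "A \<inter> Y \<noteq> {}" "A \<inter> Y \<noteq> Y" by blast
  then show "\<exists>u\<in>A. \<exists>v\<in>Z - A. (u, v) \<in> parcs G"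
  proof cases
    case disjoint
    obtain a where "a \<in> A" "a \<in> Z - Y" using A disjoint by blast
    then show ?thesis using attached[of a] Y(2) disjoint by blast
  next
    case contains
    obtain z where "z \<in> Z - A" "z \<in> Z - Y" using A contains by blast
    then show ?thesis using attached[of z] contains by (blast dest: arcs_symmetric)
  next
    case splits
    then obtain u v where "u \<in> A \<inter> Y" "v \<in> Y - A \<inter> Y" "(u, v) \<in> parcs G"
      using induces_connected_crossing_arc[OF Y(1), of "A \<inter> Y"] by blast
    then show ?thesis using Y(2) by blast
  qed
qed

lemma connected_independent_set_is_singleton:
  assumes "induces_connected X" "independent_set G X"
  shows "is_singleton X"
proof -
  obtain x where "x \<in> X" using assms(1) by (auto simp: induces_connected_iff_crossing_arc)
  moreover have "X = {x}"
  proof (rule ccontr)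
    assume "X \<noteq> {x}"
    then obtain v where "v \<in> X - {x}" "(x, v) \<in> parcs G"
      using induces_connected_crossing_arc[OF assms(1), of "{x}"] \<open>x \<in> X\<close> by blast
    then show False using assms(2) \<open>x \<in> X\<close> by (auto simp: independent_set_def)
  qed
  ultimately show ?thesis by (simp add: is_singleton_def)
qed

text \<open>
  An arc leaving \<open>B\<close> and its neighbours in \<open>S\<close> must end in \<open>A\<close>, so one vertex of \<open>S\<close> suffices to
  reach one more vertex of \<open>A\<close>.
\<close>

lemma induces_connected_extend_side:
  assumes indep: "independent_set G A" "independent_set G S"
    and connected_A_S: "induces_connected (A \<union> S)"
    and B: "B \<noteq> {}" "B \<subset> A"
    and connected_B_T: "induces_connected (B \<union> T)"
  obtains u v where "u \<in> S" "v \<in> A - B" "induces_connected (insert v B \<union> insert u T)"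
proof -
  define C where "C = B \<union> {s \<in> S. \<exists>b\<in>B. (b, s) \<in> parcs G}"
  obtain a where a: "a \<in> A - B" using B by blast
  then have "a \<notin> C" using indep(1) B(2) by (auto simp: C_def independent_set_def)
  then have "C \<noteq> {}" "C \<subseteq> A \<union> S" "C \<noteq> A \<union> S" using a B by (auto simp: C_def)
  then obtain u v where uv: "u \<in> C" "v \<in> A \<union> S - C" "(u, v) \<in> parcs G"
    by (rule induces_connected_crossing_arc[OF connected_A_S])
  then have v: "v \<in> A - B" and u: "u \<in> S" "\<exists>b\<in>B. (b, u) \<in> parcs G"
    using indep B(2) by (auto simp: C_def independent_set_def)
  have "induces_connected (insert u (B \<union> T))"
    by (rule induces_connected_superset[OF connected_B_T]) (use u in \<open>auto dest: arcs_symmetric\<close>)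
  then have "induces_connected (insert v (insert u (B \<union> T)))"
    by (rule induces_connected_superset) (use uv(3) in \<open>auto dest: arcs_symmetric\<close>)
  then show thesis using that u(1) v by (simp add: insert_commute)
qed

lemma induces_connected_bipartite_skeleton:
  assumes indep: "independent_set G A" "independent_set G S" and A: "finite A" "A \<noteq> {}"
    and connected_A_S: "induces_connected (A \<union> S)"
  obtains T where "T \<subseteq> S" "finite T" "card T < card A" "induces_connected (A \<union> T)"
proof -
  have "\<exists>B T. B \<subseteq> A \<and> card B = k \<and> T \<subseteq> S \<and> finite T \<and> card T < k \<and>
      induces_connected (B \<union> T)"
    if "1 \<le> k" "k \<le> card A" for k
    using that
  proof (induction k rule: dec_induct)
    case base
    obtain a where "a \<in> A" using A by blast
    then show ?case
      by (intro exI[of _ "{a}"] exI[of _ "{}"]) (simp add: induces_connected_singleton)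
  next
    case (step k)
    then obtain B T where BT: "B \<subseteq> A" "card B = k" "T \<subseteq> S" "finite T" "card T < k"
      "induces_connected (B \<union> T)" by auto
    then have "B \<noteq> {}" "B \<subset> A" using step by auto
    then obtain u v where uv: "u \<in> S" "v \<in> A - B"
      "induces_connected (insert v B \<union> insert u T)"
      by (rule induces_connected_extend_side[OF indep connected_A_S _ _ BT(6)])
    have "card (insert v B) = Suc k"
      using uv(2) BT A(1) finite_subset by fastforce
    moreover have "card (insert u T) < Suc k"
      using BT by (simp add: card_insert_if)
    ultimately show ?case
      using BT uv by (intro exI[of _ "insert v B"] exI[of _ "insert u T"]) simp
  qed
  from this[of "card A"] obtain B T where "B \<subseteq> A" "card B = card A" "T \<subseteq> S" "finite T"
    "card T < card A" "induces_connected (B \<union> T)"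
    using A by (auto simp: Suc_le_eq card_gt_0_iff)
  then show thesis using that card_subset_eq[OF A(1)] by metis
qed

end

subsection \<open>Extensions\<close>

context pair_graph
begin

lemma connected_dominating_set_mono:
  assumes X: "connected_dominating_set G X" and Y: "X \<subseteq> Y" "Y \<subseteq> pverts G"
  shows "connected_dominating_set G Y"
proof -
  have "induces_connected Y"
    by (rule induces_connected_superset[OF _ Y(1)])
      (use X Y(2) in \<open>auto simp: connected_dominating_set_def neighbors_def\<close>)
  moreover have "neighbors G v \<inter> Y \<noteq> {}" if "v \<in> pverts G - Y" for v
    using that X Y(1) unfolding connected_dominating_set_def by blast
  ultimately show ?thesis using Y(2) by (simp add: connected_dominating_set_def)
qed

lemma extension_mono:
  assumes "extension G In Out S" "S \<subseteq> T" "T \<subseteq> pverts G" "T \<inter> (In \<union> Out) = {}"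
  shows "extension G In Out T"
proof -
  have "connected_dominating_set G (In \<union> T)"
    by (rule connected_dominating_set_mono[of "In \<union> S"])
      (use assms in \<open>auto simp: extension_def connected_dominating_set_def\<close>)
  then show ?thesis using assms(3,4) by (simp add: extension_def)
qed

lemma minimal_extension_iff_delete:
  "minimal_extension G In Out S \<longleftrightarrow>
    extension G In Out S \<and> (\<forall>v\<in>S. \<not> extension G In Out (S - {v}))"
proof (intro iffI conjI ballI)
  assume locally_minimal: "extension G In Out S \<and> (\<forall>v\<in>S. \<not> extension G In Out (S - {v}))"
  have "\<not> extension G In Out S'" if proper: "S' \<subset> S" for S'
  proof
    assume S': "extension G In Out S'"
    obtain v where v: "v \<in> S" "v \<notin> S'" using proper by blast
    have "extension G In Out (S - {v})"
      by (rule extension_mono[OF S'])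
        (use proper v locally_minimal in \<open>auto simp: extension_def\<close>)
    then show False using locally_minimal v(1) by blast
  qed
  then show "minimal_extension G In Out S"
    using locally_minimal by (simp add: minimal_extension_def)
qed (auto simp: minimal_extension_def)

end

locale bipartite_extension = pair_graph G for G :: "'a pair_pre_digraph" +
  fixes L In Out :: "'a set"
  assumes pverts_eq: "pverts G = L \<union> (In \<union> Out)"
    and disjoint: "L \<inter> (In \<union> Out) = {}" "In \<inter> Out = {}"
    and independent: "independent_set G L" "independent_set G (In \<union> Out)"
begin

lemma finite_sides: "finite L" "finite In" "finite Out"
  using pair_finite_verts pverts_eq by auto

lemma extension_subset: "extension G In Out S \<Longrightarrow> S \<subseteq> L"
  using pverts_eq by (auto simp: extension_def)

lemma extension_eq_if_no_In_Out:
  assumes "In \<union> Out = {}" "extension G In Out S"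
  shows "S = L"
proof
  show "S \<subseteq> L" using assms(2) by (rule extension_subset)
  have "\<exists>w\<in>S. (v, w) \<in> parcs G" if "v \<in> L - S" for v
    using that assms pverts_eq
    by (auto simp: extension_def connected_dominating_set_def neighbors_def)
  then show "L \<subseteq> S" using \<open>S \<subseteq> L\<close> independent(1) unfolding independent_set_def by blast
qed

lemma extension_iff:
  assumes "In \<noteq> {}"
  shows "extension G In Out S \<longleftrightarrow> S \<subseteq> L \<and> induces_connected (In \<union> S) \<and>
    (\<forall>v\<in>L. \<exists>w\<in>In. (v, w) \<in> parcs G) \<and> (\<forall>v\<in>Out. \<exists>w\<in>S. (v, w) \<in> parcs G)"
    (is "_ \<longleftrightarrow> ?rhs")
proof
  assume ext: "extension G In Out S"
  then have S: "S \<subseteq> L" by (rule extension_subset)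
  have connected: "induces_connected (In \<union> S)"
    and dominated: "\<And>v. v \<in> pverts G - (In \<union> S) \<Longrightarrow> \<exists>w\<in>In \<union> S. (v, w) \<in> parcs G"
    using ext by (auto simp: extension_def connected_dominating_set_def neighbors_def)
  have "\<exists>w\<in>In \<union> S. (v, w) \<in> parcs G" if "v \<in> L" for v
  proof (cases "v \<in> S")
    case True
    have "{v} \<noteq> In \<union> S" using that assms disjoint by auto
    then show ?thesis
      using True induces_connected_crossing_arc[OF connected, of "{v}"] by blast
  next
    case False
    then show ?thesis using that dominated pverts_eq disjoint by blast
  qed
  moreover have "\<exists>w\<in>In \<union> S. (v, w) \<in> parcs G" if "v \<in> Out" for v
    using that dominated S pverts_eq disjoint by blast
  ultimately show ?rhs
    using S connected independent unfolding independent_set_def by blast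
next
  assume ?rhs
  then show "extension G In Out S"
    using pverts_eq disjoint
    by (auto simp: extension_def connected_dominating_set_def neighbors_def)
qed

lemma card_minimal_extension_less:
  assumes "In \<noteq> {}" and S: "minimal_extension G In Out S"
  shows "card S < card (In \<union> Out)"
proof -
  have "extension G In Out S" using S by (simp add: minimal_extension_def)
  then have "S \<subseteq> L" and connected: "induces_connected (In \<union> S)"
    and L_dominated: "\<forall>v\<in>L. \<exists>w\<in>In. (v, w) \<in> parcs G"
    and Out_dominated: "\<forall>v\<in>Out. \<exists>w\<in>S. (v, w) \<in> parcs G"
    by (simp_all add: extension_iff[OF assms(1)])
  have "independent_set G In" "independent_set G S"
    using \<open>S \<subseteq> L\<close> independent by (auto intro: independent_set_subset)
  then obtain T where T: "T \<subseteq> S" "card T < card In" "induces_connected (In \<union> T)"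
    by (rule induces_connected_bipartite_skeleton[OF _ _ finite_sides(2) assms(1) connected])
  obtain f where f: "\<forall>v\<in>Out. f v \<in> S \<and> (v, f v) \<in> parcs G"
    using Out_dominated by metis
  have T_f_subset: "T \<union> f ` Out \<subseteq> S" using T(1) f by auto
  have "induces_connected (In \<union> (T \<union> f ` Out))"
  proof (rule induces_connected_superset[OF T(3)])
    fix v assume "v \<in> In \<union> (T \<union> f ` Out) - (In \<union> T)"
    then have "v \<in> L" using T_f_subset \<open>S \<subseteq> L\<close> by auto
    then show "\<exists>w\<in>In \<union> T. (v, w) \<in> parcs G" using L_dominated by auto
  qed auto
  then have "extension G In Out (T \<union> f ` Out)"
    unfolding extension_iff[OF assms(1)]
    using L_dominated T_f_subset \<open>S \<subseteq> L\<close> f by auto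
  then have "S = T \<union> f ` Out"
    using S T_f_subset unfolding minimal_extension_def by blast
  then have "card S \<le> card T + card (f ` Out)" by (simp add: card_Un_le)
  also have "\<dots> < card In + card Out"
    using T(2) card_image_le[OF finite_sides(3), of f] by linarith
  also have "\<dots> = card (In \<union> Out)"
    using finite_sides disjoint by (simp add: card_Un_disjoint)
  finally show ?thesis .
qed

lemma card_minimal_extension_le:
  assumes S: "minimal_extension G In Out S"
  shows "card S \<le> max 1 (card (In \<union> Out))"
proof (cases "In = {}")
  case True
  have ext: "extension G In Out S" using S by (simp add: minimal_extension_def)
  then have "independent_set G S"
    using extension_subset independent(1) by (blast intro: independent_set_subset)
  then have "is_singleton S"
    using ext True connected_independent_set_is_singleton
    by (simp add: extension_def connected_dominating_set_def)
  then show ?thesis by (auto simp: is_singleton_def)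
next
  case False
  then show ?thesis using card_minimal_extension_less[OF False S] by simp
qed

end

subsection \<open>Excellent partitions\<close>

lemma excellent_partition_independent_set:
  "excellent_partition l G L H R \<Longrightarrow> independent_set G (H \<union> R)"
  by (auto simp: excellent_partition_def good_partition_def independent_set_def)

lemma excellent_partition_bipartite_extension:
  assumes G: "pair_graph G" and part: "excellent_partition l G L H R"
    and In_Out: "In \<union> Out = H \<union> R" "In \<inter> Out = {}"
  shows "bipartite_extension G L In Out"
proof -
  have "pverts G = L \<union> (H \<union> R)" "L \<inter> (H \<union> R) = {}" "independent_set G L"
    using part by (auto simp: excellent_partition_def good_partition_def)
  then show ?thesis
    using G In_Out excellent_partition_independent_set[OF part]
    by (simp add: bipartite_extension_def bipartite_extension_axioms_def)
qed

lemma double_counting_le: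
  fixes d c :: nat
  assumes "finite A" "finite B"
    and "\<And>a. a \<in> A \<Longrightarrow> d \<le> card {b \<in> B. P a b}"
    and "\<And>b. b \<in> B \<Longrightarrow> card {a \<in> A. P a b} \<le> c"
  shows "card A * d \<le> card B * c"
proof -
  have "card A * d \<le> (\<Sum>a\<in>A. card {b \<in> B. P a b})"
    using sum_bounded_below[of A d] assms(3) by simp
  also have "\<dots> = (\<Sum>b\<in>B. card {a \<in> A. P a b})"
    by (rule sum_multicount_gen) (use assms(1,2) in auto)
  also have "\<dots> \<le> card B * c"
    using sum_bounded_above[of B _ c] assms(4) by simp
  finally show ?thesis .
qed

lemma (in pair_graph) card_high_degree_le:
  assumes part: "excellent_partition l G L H R"
  shows "card {v \<in> R. d \<le> degree G v} * d \<le> card L * l"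
proof (rule double_counting_le[where P = "\<lambda>v w. (v, w) \<in> parcs G"])
  have part_eq: "L \<union> H \<union> R = pverts G"
    and few_R: "\<forall>w\<in>L. card (neighbors G w \<inter> R) < l"
    using part by (auto simp: excellent_partition_def good_partition_def)
  have fin: "finite L" "finite R" using pair_finite_verts part_eq by (metis finite_Un)+
  then show "finite L" "finite {v \<in> R. d \<le> degree G v}" by simp_all
  show "d \<le> card {w \<in> L. (v, w) \<in> parcs G}" if "v \<in> {v \<in> R. d \<le> degree G v}" for v
  proof -
    have "neighbors G v = {w \<in> L. (v, w) \<in> parcs G}"
      using that part_eq excellent_partition_independent_set[OF part] in_arcsD2
      by (auto simp: neighbors_def independent_set_def)
    then show ?thesis using that by (simp add: degree_def)
  qed
  show "card {v \<in> {v \<in> R. d \<le> degree G v}. (v, w) \<in> parcs G} \<le> l" if "w \<in> L" for w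
  proof -
    have "{v \<in> {v \<in> R. d \<le> degree G v}. (v, w) \<in> parcs G} \<subseteq> neighbors G w \<inter> R"
      by (auto simp: neighbors_def dest: arcs_symmetric)
    then have "card {v \<in> {v \<in> R. d \<le> degree G v}. (v, w) \<in> parcs G}
      \<le> card (neighbors G w \<inter> R)"
      using fin(2) by (intro card_mono) auto
    also have "\<dots> < l" using few_R that by blast
    finally show ?thesis by simp
  qed
qed

lemma (in pair_graph) card_excellent_partition_le:
  assumes "l \<ge> 1" and part: "excellent_partition l G L H R"
    and low: "real (card {v \<in> R. degree G v < 10 * l}) \<le> real (card L) / 10"
  shows "10 * card (H \<union> R) \<le> 3 * card L"
proof -
  have "10 * card {v \<in> R. 10 * l \<le> degree G v} \<le> card L"
    using card_high_degree_le[OF part, of "10 * l"] \<open>l \<ge> 1\<close> by simp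
  moreover have "card R \<le> card {v \<in> R. 10 * l \<le> degree G v} + card {v \<in> R. degree G v < 10 * l}"
  proof -
    have "R = {v \<in> R. 10 * l \<le> degree G v} \<union> {v \<in> R. degree G v < 10 * l}" by auto
    then show ?thesis by (metis card_Un_le)
  qed
  moreover have "10 * card H \<le> card L"
    using part by (simp add: excellent_partition_def good_partition_def)
  moreover have "card (H \<union> R) \<le> card H + card R" by (rule card_Un_le)
  ultimately show ?thesis using low by linarith
qed

subsection \<open>Counting small subsets\<close>

text \<open>Weigh a subset \<open>S\<close> by \<open>x ^ |S|\<close>.\<close>

lemma card_small_subsets_weighted_le:
  fixes x :: real
  assumes A: "finite A" and x: "0 \<le> x" "x \<le> 1"
  shows "real (card {S. S \<subseteq> A \<and> card S \<le> k}) * x ^ k \<le> (1 + x) ^ card A"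
proof -
  have "real (card {S. S \<subseteq> A \<and> card S \<le> k}) * x ^ k \<le> (\<Sum>S | S \<subseteq> A \<and> card S \<le> k. x ^ card S)"
    by (rule sum_bounded_below) (use x in \<open>auto intro: power_decreasing\<close>)
  also have "\<dots> \<le> (\<Sum>S\<in>Pow A. x ^ card S)"
    by (rule sum_mono2) (use A x in auto)
  also have "\<dots> = (1 + x) ^ card A"
    using prod_add[OF A, of "\<lambda>_. x" "\<lambda>_. 1"] by (simp add: add.commute)
  finally show ?thesis .
qed

lemma card_small_subsets_le:
  assumes "finite A"
  shows "real (card {S. S \<subseteq> A \<and> card S \<le> k}) \<le> 2 ^ k * (3 / 2) ^ card A"
  using card_small_subsets_weighted_le[OF assms, of "1 / 2" k]
  by (simp add: power_one_over field_simps)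

lemma two_power_times_three_halves_power_le:
  assumes "10 * k \<le> 3 * m"
  shows "2 ^ k * (3 / 2) ^ m \<le> 2 powr (9 / 10 * real m)"
proof -
  have "(3 / 2 :: real) ^ 10 \<le> (2 powr (6 / 10)) ^ 10"
    by (simp add: powr_power power_divide)
  then have "(3 / 2 :: real) \<le> 2 powr (6 / 10)"
    by (rule power_le_imp_le_base[where n = 9, simplified]) simp
  then have "(3 / 2 :: real) ^ m \<le> (2 powr (6 / 10)) ^ m"
    by (rule power_mono) simp
  moreover have "(2 :: real) ^ k \<le> 2 powr (3 / 10 * real m)"
    using assms by (simp flip: powr_realpow)
  ultimately have "2 ^ k * (3 / 2) ^ m \<le> 2 powr (3 / 10 * real m) * (2 powr (6 / 10)) ^ m"
    by (intro mult_mono) auto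
  also have "\<dots> = 2 powr (9 / 10 * real m)"
    by (simp add: powr_power mult.commute flip: powr_add)
  finally show ?thesis .
qed

lemma (in bipartite_extension) card_minimal_extensions_le:
  assumes "10 * card (In \<union> Out) \<le> 3 * card L"
  shows "real (card {S. minimal_extension G In Out S}) \<le> 2 powr (9 / 10 * real (card L))"
proof (cases "In \<union> Out = {}")
  case True
  have "{S. minimal_extension G In Out S} \<subseteq> {L}"
    using extension_eq_if_no_In_Out[OF True] by (auto simp: minimal_extension_def)
  then have "real (card {S. minimal_extension G In Out S}) \<le> 1"
    using card_mono[of "{L}"] by fastforce
  also have "\<dots> \<le> 2 powr (9 / 10 * real (card L))"
    by (simp add: ge_one_powr_ge_zero)
  finally show ?thesis .
next
  case False
  then have "1 \<le> card (In \<union> Out)"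
    using finite_sides by (simp add: Suc_le_eq card_gt_0_iff)
  then have "{S. minimal_extension G In Out S} \<subseteq> {S. S \<subseteq> L \<and> card S \<le> card (In \<union> Out)}"
    using card_minimal_extension_le extension_subset
    by (fastforce simp: minimal_extension_def)
  then have "real (card {S. minimal_extension G In Out S})
    \<le> real (card {S. S \<subseteq> L \<and> card S \<le> card (In \<union> Out)})"
    using finite_sides(1) by (intro of_nat_mono card_mono) auto
  also have "\<dots> \<le> 2 ^ card (In \<union> Out) * (3 / 2) ^ card L"
    by (rule card_small_subsets_le[OF finite_sides(1)])
  also have "\<dots> \<le> 2 powr (9 / 10 * real (card L))"
    by (rule two_power_times_three_halves_power_le[OF assms])
  finally show ?thesis .
qed


subsection \<open>Evaluation within a time bound\<close>

definition evalto_within :: "program \<Rightarrow> btree list \<Rightarrow> expr \<Rightarrow> btree \<Rightarrow> nat \<Rightarrow> bool" where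
  "evalto_within P env e v T \<longleftrightarrow> (\<exists>t\<le>T. evalto P env e v t)"

definition evalsto_within ::
  "program \<Rightarrow> btree list \<Rightarrow> expr list \<Rightarrow> btree list \<Rightarrow> nat \<Rightarrow> bool" where
  "evalsto_within P env es vs T \<longleftrightarrow> (\<exists>t\<le>T. evalsto P env es vs t)"

text \<open>
  The branch of a conditional is judged only after the value of its condition is known; this
  makes the evaluation rules applicable by plain resolution, without backtracking.
\<close>

definition branchto_within ::
  "program \<Rightarrow> btree list \<Rightarrow> btree \<Rightarrow> expr \<Rightarrow> expr \<Rightarrow> btree \<Rightarrow> nat \<Rightarrow> bool" where
  "branchto_within P env c e1 e2 v T \<longleftrightarrow> evalto_within P env (if c = Leaf then e2 else e1) v T"

definition callto_within :: "program \<Rightarrow> nat \<Rightarrow> btree list \<Rightarrow> btree \<Rightarrow> nat \<Rightarrow> bool" where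
  "callto_within P f xs v T \<longleftrightarrow> f < length P \<and> evalto_within P xs (P ! f) v T"

definition has_body :: "program \<Rightarrow> nat \<Rightarrow> expr \<Rightarrow> bool" where
  "has_body P f e \<longleftrightarrow> f < length P \<and> P ! f = e"

lemma callto_withinI:
  "has_body P f e \<Longrightarrow> evalto_within P xs e v s \<Longrightarrow> v = v' \<Longrightarrow> s \<le> t \<Longrightarrow> callto_within P f xs v' t"
  unfolding has_body_def callto_within_def evalto_within_def using order_trans by blast

lemma callto_within_mono: "callto_within P f xs v s \<Longrightarrow> s \<le> t \<Longrightarrow> callto_within P f xs v t"
  unfolding callto_within_def evalto_within_def using order_trans by blast

lemma evalto_within_Var:
  "evalto_within P (x # env) (Var 0) x 1"
  "evalto_within P (x # y # env) (Var 1) y 1"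
  "evalto_within P (x # y # z # env) (Var 2) z 1"
  "evalto_within P (x # y # z # w # env) (Var 3) w 1"
  using evalto_Var[of 0 "x # env" P] evalto_Var[of 1 "x # y # env" P]
    evalto_Var[of 2 "x # y # z # env" P] evalto_Var[of 3 "x # y # z # w # env" P]
  by (auto simp: evalto_within_def)

lemma evalto_within_Nil: "evalto_within P env NilE Leaf 1"
  unfolding evalto_within_def using evalto_Nil by blast

lemma evalto_within_Pair:
  "evalto_within P env e1 x s \<Longrightarrow> evalto_within P env e2 y t \<Longrightarrow>
    evalto_within P env (PairE e1 e2) (Node x y) (s + t + 1)"
  unfolding evalto_within_def using evalto_Pair by (metis add_le_mono order_refl)

lemma evalto_within_Fst:
  "evalto_within P env e (Node x y) t \<Longrightarrow> evalto_within P env (FstE e) x (t + 1)"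
  unfolding evalto_within_def using evalto_Fst by (metis add_le_mono order_refl)

lemma evalto_within_Snd:
  "evalto_within P env e (Node x y) t \<Longrightarrow> evalto_within P env (SndE e) y (t + 1)"
  unfolding evalto_within_def using evalto_Snd by (metis add_le_mono order_refl)

lemma evalto_within_If:
  assumes "evalto_within P env e c s" "branchto_within P env c e1 e2 v t"
  shows "evalto_within P env (IfE e e1 e2) v (s + t + 1)"
proof (cases c)
  case Leaf
  then show ?thesis
    using assms evalto_If_Leaf[of P env e _ e2 v _ e1]
    unfolding evalto_within_def branchto_within_def by (metis add_le_mono order_refl)
next
  case (Node x y)
  then show ?thesis
    using assms evalto_If_Node[of P env e x y _ e1 v _ e2]
    unfolding evalto_within_def branchto_within_def
    by (metis add_le_mono order_refl btree.distinct(1))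
qed

lemma branchto_within_Node:
  "evalto_within P env e1 v t \<Longrightarrow> branchto_within P env (Node x y) e1 e2 v t"
  by (simp add: branchto_within_def)

lemma branchto_within_Leaf:
  "evalto_within P env e2 v t \<Longrightarrow> branchto_within P env Leaf e1 e2 v t"
  by (simp add: branchto_within_def)

lemma branchto_within_bool:
  "(b \<Longrightarrow> evalto_within P env e1 v s) \<Longrightarrow> (\<not> b \<Longrightarrow> evalto_within P env e2 w t) \<Longrightarrow>
    branchto_within P env (enc_bool b) e1 e2 (if b then v else w) (if b then s else t)"
  by (simp add: branchto_within_def enc_bool_def)

lemma evalto_within_App:
  "evalsto_within P env es xs s \<Longrightarrow> callto_within P f xs v t \<Longrightarrow>
    evalto_within P env (App f es) v (s + t + 1)"
  unfolding evalto_within_def evalsto_within_def callto_within_def using evalto_App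
  by (metis add_le_mono order_refl)

lemma evalsto_within_Nil: "evalsto_within P env [] [] 0"
  by (auto simp: evalsto_within_def intro: evalsto_Nil)

lemma evalsto_within_Cons:
  "evalto_within P env e x s \<Longrightarrow> evalsto_within P env es xs t \<Longrightarrow>
    evalsto_within P env (e # es) (x # xs) (s + t)"
  unfolding evalto_within_def evalsto_within_def using evalsto_Cons by (metis add_le_mono)

lemmas evalto_within_rules =
  evalto_within_Var evalto_within_Nil evalto_within_Pair evalto_within_Fst evalto_within_Snd
  evalto_within_If branchto_within_Node branchto_within_Leaf branchto_within_bool
  evalto_within_App evalsto_within_Nil evalsto_within_Cons

lemma computes_in_time_if_callto_within:
  assumes "callto_within P 0 [x] y T"
  obtains t where "t \<le> T + 2" "computes_in_time P x y t"
proof -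
  have "evalto_within P [x] (App 0 [Var 0]) y (1 + 0 + T + 1)"
    by (rule evalto_within_rules assms)+
  then show thesis using that by (auto simp: evalto_within_def computes_in_time_def)
qed

subsection \<open>The enumeration program\<close>

abbreviation (input) "TrueE \<equiv> PairE NilE NilE"
abbreviation (input) "FalseE \<equiv> NilE"

abbreviation (input) "main_fn \<equiv> 0 :: nat"
abbreviation (input) "meets_fn \<equiv> 1 :: nat"
abbreviation (input) "union_fn \<equiv> 2 :: nat"
abbreviation (input) "first_fn \<equiv> 3 :: nat"
abbreviation (input) "grow_fn \<equiv> 4 :: nat"
abbreviation (input) "iterate_fn \<equiv> 5 :: nat"
abbreviation (input) "check_fn \<equiv> 6 :: nat"
abbreviation (input) "cds_fn \<equiv> 7 :: nat"
abbreviation (input) "extension_fn \<equiv> 8 :: nat"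
abbreviation (input) "prefix_fn \<equiv> 9 :: nat"
abbreviation (input) "deletions_fn \<equiv> 10 :: nat"
abbreviation (input) "none_fn \<equiv> 11 :: nat"
abbreviation (input) "minimal_fn \<equiv> 12 :: nat"
abbreviation (input) "filter_fn \<equiv> 13 :: nat"
abbreviation (input) "subsets_fn \<equiv> 14 :: nat"
abbreviation (input) "budget_fn \<equiv> 15 :: nat"

definition meets_body :: expr where
  "meets_body = IfE (Var 0)
     (IfE (FstE (Var 0))
        (IfE (FstE (Var 1)) TrueE (App meets_fn [SndE (Var 0), SndE (Var 1)]))
        (App meets_fn [SndE (Var 0), SndE (Var 1)]))
     FalseE"

definition union_body :: expr where
  "union_body = IfE (Var 0)
     (PairE (IfE (FstE (Var 0)) TrueE (FstE (Var 1)))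
        (App union_fn [SndE (Var 0), SndE (Var 1)]))
     NilE"

text \<open>The second argument tells whether a vertex has been kept already.\<close>

definition first_body :: expr where
  "first_body = IfE (Var 0)
     (IfE (Var 1) (PairE FalseE (App first_fn [SndE (Var 0), Var 1]))
        (PairE (FstE (Var 0)) (App first_fn [SndE (Var 0), FstE (Var 0)])))
     NilE"

text \<open>
  The arguments are the rows of the adjacency matrix still to be treated, the corresponding
  parts of two vertex sets \<open>X\<close> and \<open>Y\<close>, and all of \<open>Y\<close> (of \<open>X\<close> in \<open>check_body\<close>).
\<close>

definition grow_body :: expr where
  "grow_body = IfE (Var 0)
     (PairE
        (IfE (FstE (Var 2)) TrueE
           (IfE (FstE (Var 1)) (App meets_fn [FstE (Var 0), Var 3]) FalseE))
        (App grow_fn [SndE (Var 0), SndE (Var 1), SndE (Var 2), Var 3]))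
     NilE"

definition check_body :: expr where
  "check_body = IfE (Var 0)
     (IfE (FstE (Var 1))
        (IfE (FstE (Var 2))
           (App check_fn [SndE (Var 0), SndE (Var 1), SndE (Var 2), Var 3]) FalseE)
        (IfE (App meets_fn [FstE (Var 0), Var 3])
           (App check_fn [SndE (Var 0), SndE (Var 1), SndE (Var 2), Var 3]) FalseE))
     TrueE"

definition iterate_body :: expr where
  "iterate_body = IfE (Var 0)
     (App iterate_fn [SndE (Var 0), Var 1, Var 2, App grow_fn [Var 1, Var 2, Var 3, Var 3]])
     (Var 3)"

text \<open>
  The component of the first vertex of the given set is the fixed point reached after \<open>n\<close> rounds
  of adding adjacent vertices of that set; the rows of the adjacency matrix serve as the counter.
\<close>

definition cds_body :: expr where
  "cds_body = IfE (Var 0)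
     (App check_fn [Var 0, Var 1,
        App iterate_fn [Var 0, Var 0, Var 1, App first_fn [Var 1, FalseE]], Var 1])
     FalseE"

definition extension_body :: expr where
  "extension_body = App cds_fn [Var 0, App union_fn [Var 1, Var 2]]"

definition prefix_body :: expr where
  "prefix_body = IfE (Var 1)
     (PairE (PairE (Var 0) (FstE (Var 1))) (App prefix_fn [Var 0, SndE (Var 1), Var 2]))
     (Var 2)"

definition deletions_body :: expr where
  "deletions_body = IfE (Var 0)
     (IfE (FstE (Var 0))
        (PairE (PairE FalseE (SndE (Var 0)))
           (App prefix_fn [TrueE, App deletions_fn [SndE (Var 0)], NilE]))
        (App prefix_fn [FalseE, App deletions_fn [SndE (Var 0)], NilE]))
     NilE"

definition none_body :: expr where
  "none_body = IfE (Var 0)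
     (IfE (App extension_fn [Var 1, Var 2, FstE (Var 0)]) FalseE
        (App none_fn [SndE (Var 0), Var 1, Var 2]))
     TrueE"

definition minimal_body :: expr where
  "minimal_body = IfE (App extension_fn [Var 0, Var 1, Var 2])
     (App none_fn [App deletions_fn [Var 2], Var 0, Var 1]) FalseE"

definition filter_body :: expr where
  "filter_body = IfE (Var 0)
     (IfE (App minimal_fn [Var 1, Var 2, FstE (Var 0)])
        (PairE (FstE (Var 0)) (App filter_fn [SndE (Var 0), Var 1, Var 2]))
        (App filter_fn [SndE (Var 0), Var 1, Var 2]))
     NilE"

definition subsets_body :: expr where
  "subsets_body = IfE (Var 0)
     (App prefix_fn [FalseE, App subsets_fn [SndE (Var 0), Var 1],
        IfE (FstE (Var 0))
          (IfE (Var 1)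
             (App prefix_fn [TrueE, App subsets_fn [SndE (Var 0), SndE (Var 1)], NilE]) NilE)
          NilE])
     (PairE NilE NilE)"

text \<open>
  The unary number \<open>k + 1\<close>, where \<open>k\<close> is the size of the complement of the argument. For \<open>k = 0\<close>
  the graph may consist of a single vertex, and the minimal extension then has \<open>k + 1\<close> elements.
\<close>

definition budget_body :: expr where
  "budget_body = IfE (Var 0)
     (IfE (FstE (Var 0)) (App budget_fn [SndE (Var 0)])
        (PairE NilE (App budget_fn [SndE (Var 0)])))
     (PairE NilE NilE)"

definition main_body :: expr where
  "main_body =
     App filter_fn
       [App subsets_fn [FstE (SndE (Var 0)), App budget_fn [FstE (SndE (Var 0))]],
        FstE (Var 0), FstE (SndE (SndE (SndE (SndE (Var 0)))))]"

definition prog :: program where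
  "prog = [main_body, meets_body, union_body, first_body, grow_body, iterate_body, check_body,
     cds_body, extension_body, prefix_body, deletions_body, none_body, minimal_body,
     filter_body, subsets_body, budget_body]"

lemma has_body_prog:
  "has_body prog main_fn main_body" "has_body prog meets_fn meets_body"
  "has_body prog union_fn union_body" "has_body prog first_fn first_body"
  "has_body prog grow_fn grow_body" "has_body prog iterate_fn iterate_body"
  "has_body prog check_fn check_body" "has_body prog cds_fn cds_body"
  "has_body prog extension_fn extension_body" "has_body prog prefix_fn prefix_body"
  "has_body prog deletions_fn deletions_body" "has_body prog none_fn none_body"
  "has_body prog minimal_fn minimal_body" "has_body prog filter_fn filter_body"
  "has_body prog subsets_fn subsets_body" "has_body prog budget_fn budget_body"
  by (simp_all add: has_body_def prog_def)

lemmas callto_within_progI = has_body_prog[THEN callto_withinI]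

subsection \<open>Bit vectors, matrices and unary numbers\<close>

definition bits :: "'a set \<Rightarrow> 'a list \<Rightarrow> btree" where
  "bits X vs = enc_list (map (\<lambda>v. enc_bool (v \<in> X)) vs)"

lemma bits_simps:
  "bits X [] = Leaf" "bits X (v # vs) = Node (enc_bool (v \<in> X)) (bits X vs)"
  by (simp_all add: bits_def)

lemma bits_cong: "(\<And>v. v \<in> set vs \<Longrightarrow> v \<in> X \<longleftrightarrow> v \<in> Y) \<Longrightarrow> bits X vs = bits Y vs"
  by (simp add: bits_def cong: map_cong)

definition rows :: "('a \<Rightarrow> 'a set) \<Rightarrow> 'a list \<Rightarrow> 'a list \<Rightarrow> btree" where
  "rows N ws vs = enc_list (map (\<lambda>v. bits (N v) ws) vs)"

lemma rows_simps:
  "rows N ws [] = Leaf" "rows N ws (v # vs) = Node (bits (N v) ws) (rows N ws vs)"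
  by (simp_all add: rows_def)

definition unary :: "nat \<Rightarrow> btree" where
  "unary k = enc_list (replicate k Leaf)"

lemma unary_simps: "unary 0 = Leaf" "unary (Suc k) = Node Leaf (unary k)"
  by (simp_all add: unary_def)

lemma enc_bool_simps: "enc_bool True = Node Leaf Leaf" "enc_bool False = Leaf"
  by (simp_all add: enc_bool_def)

lemma foldr_Node_enc_list: "foldr Node xs (enc_list ys) = enc_list (xs @ ys)"
  by (induction xs) simp_all

lemma foldr_Node_Leaf: "foldr Node xs Leaf = enc_list xs"
  using foldr_Node_enc_list[of xs "[]"] by simp

subsection \<open>Running time of the connectivity test\<close>

text \<open>
  The proofs below execute a body symbolically: resolution with the evaluation rules computes its
  value and a time bound, which are then compared with those claimed.
\<close>

lemma callto_meets:
  "callto_within prog meets_fn [bits A vs, bits B vs]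
    (enc_bool (A \<inter> B \<inter> set vs \<noteq> {})) (20 * (length vs + 1))"
proof (induction vs)
  case Nil
  show ?case
    by (rule callto_within_progI, unfold meets_body_def bits_simps, (rule evalto_within_rules)+)
      (auto simp: enc_bool_simps)
next
  case (Cons v vs)
  show ?case
    by (rule callto_within_progI, unfold meets_body_def bits_simps,
      (rule evalto_within_rules Cons.IH)+) (auto simp: enc_bool_simps)
qed

lemma callto_union:
  "callto_within prog union_fn [bits A vs, bits B vs] (bits (A \<union> B) vs) (20 * (length vs + 1))"
proof (induction vs)
  case Nil
  show ?case
    by (rule callto_within_progI, unfold union_body_def bits_simps, (rule evalto_within_rules)+)
      auto
next
  case (Cons v vs)
  show ?case
    by (rule callto_within_progI, unfold union_body_def bits_simps,
      (rule evalto_within_rules Cons.IH)+) (auto simp: enc_bool_simps)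
qed

definition first_in :: "'a set \<Rightarrow> 'a list \<Rightarrow> 'a set" where
  "first_in X vs = set (take 1 (filter (\<lambda>v. v \<in> X) vs))"

lemma first_in_subset: "first_in X vs \<subseteq> X \<inter> set vs"
  by (auto simp: first_in_def dest: in_set_takeD)

lemma first_in_eq_singleton:
  assumes "X \<inter> set vs \<noteq> {}"
  obtains x where "x \<in> X" "first_in X vs = {x}"
proof -
  have "filter (\<lambda>v. v \<in> X) vs \<noteq> []" using assms by (auto simp: filter_empty_conv)
  then obtain x xs where "filter (\<lambda>v. v \<in> X) vs = x # xs" by (auto simp: neq_Nil_conv)
  then have "first_in X vs = {x}" by (simp add: first_in_def)
  then show thesis using that first_in_subset[of X vs] by blast
qed

lemma first_in_Cons: "first_in X (v # vs) = (if v \<in> X then {v} else first_in X vs)"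
  by (simp add: first_in_def)

lemma callto_first:
  assumes "distinct vs"
  shows "callto_within prog first_fn [bits X vs, enc_bool b]
    (bits (if b then {} else first_in X vs) vs) (20 * (length vs + 1))"
  using assms
proof (induction vs arbitrary: b)
  case Nil
  show ?case
    by (rule callto_within_progI, unfold first_body_def bits_simps, (rule evalto_within_rules)+)
      auto
next
  case (Cons v vs)
  then have IH: "callto_within prog first_fn [bits X vs, enc_bool b]
      (bits (if b then {} else first_in X vs) vs) (20 * (length vs + 1))"
    for b
    by simp
  have "v \<notin> first_in X vs" using first_in_subset[of X vs] Cons.prems by auto
  moreover have "bits {v} vs = bits {} vs" using Cons.prems by (auto intro: bits_cong)
  ultimately show ?case
    by - (rule callto_within_progI, unfold first_body_def bits_simps,
      (rule evalto_within_rules IH)+, auto simp: first_in_Cons enc_bool_simps)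
qed

definition grow :: "('a \<Rightarrow> 'a set) \<Rightarrow> 'a list \<Rightarrow> 'a set \<Rightarrow> 'a set \<Rightarrow> 'a set" where
  "grow N ws X Y = Y \<union> {v \<in> X. N v \<inter> Y \<inter> set ws \<noteq> {}}"

lemma callto_grow:
  "callto_within prog grow_fn [rows N ws vs, bits X vs, bits Y vs, bits Y ws]
    (bits (grow N ws X Y) vs) (60 * (length ws + 1) * (length vs + 1))"
proof (induction vs)
  case Nil
  show ?case
    by (rule callto_within_progI, unfold grow_body_def bits_simps rows_simps,
      (rule evalto_within_rules)+) auto
next
  case (Cons v vs)
  show ?case
    by (rule callto_within_progI, unfold grow_body_def bits_simps rows_simps,
      (rule evalto_within_rules Cons.IH callto_meets)+) (auto simp: enc_bool_simps grow_def)
qed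

lemma callto_iterate:
  "callto_within prog iterate_fn [enc_list us, rows N ws ws, bits X ws, bits Y ws]
    (bits ((grow N ws X ^^ length us) Y) ws) (80 * (length ws + 1)\<^sup>2 * (length us + 1))"
proof (induction us arbitrary: Y)
  case Nil
  show ?case
    by (rule callto_within_progI, unfold iterate_body_def enc_list.simps,
      (rule evalto_within_rules)+) (auto simp: power2_eq_square)
next
  case (Cons u us)
  define c where "c = (length ws + 1)\<^sup>2"
  have "1 \<le> c" by (simp add: c_def)
  moreover have grow: "callto_within prog grow_fn
    [rows N ws ws, bits X ws, bits Y ws, bits Y ws] (bits (grow N ws X Y) ws) (60 * c)" for Y
    using callto_grow[of N ws ws X Y] by (simp add: c_def power2_eq_square algebra_simps)
  ultimately show ?case
    unfolding c_def[symmetric]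
    by - (rule callto_within_progI, unfold iterate_body_def enc_list.simps,
      (rule evalto_within_rules Cons.IH[folded c_def] grow)+,
      simp_all add: funpow_swap1 algebra_simps)
qed

lemma callto_check:
  "callto_within prog check_fn [rows N ws vs, bits X vs, bits Y vs, bits X ws]
    (enc_bool (\<forall>v\<in>set vs. if v \<in> X then v \<in> Y else N v \<inter> X \<inter> set ws \<noteq> {}))
    (40 * (length ws + 1) * (length vs + 1))"
proof (induction vs)
  case Nil
  show ?case
    by (rule callto_within_progI, unfold check_body_def bits_simps rows_simps,
      (rule evalto_within_rules)+) (auto simp: enc_bool_simps)
next
  case (Cons v vs)
  show ?case
    by (rule callto_within_progI, unfold check_body_def bits_simps rows_simps,
      (rule evalto_within_rules Cons.IH callto_meets)+) (auto simp: enc_bool_simps)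
qed

definition cds_test :: "('a \<Rightarrow> 'a set) \<Rightarrow> 'a list \<Rightarrow> 'a set \<Rightarrow> bool" where
  "cds_test N ws X \<longleftrightarrow> ws \<noteq> [] \<and>
    (\<forall>v\<in>set ws. if v \<in> X then v \<in> (grow N ws X ^^ length ws) (first_in X ws)
      else N v \<inter> X \<inter> set ws \<noteq> {})"

lemma callto_cds:
  assumes "distinct ws"
  shows "callto_within prog cds_fn [rows N ws ws, bits X ws] (enc_bool (cds_test N ws X))
    (200 * (length ws + 1) ^ 3)"
proof (cases "ws = []")
  case True
  show ?thesis
    unfolding True
    by (rule callto_within_progI, unfold cds_body_def rows_simps, (rule evalto_within_rules)+)
      (auto simp: cds_test_def enc_bool_simps)
next
  case False
  then have branch: "branchto_within P env (rows N ws ws) e1 e2 v t"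
    if "evalto_within P env e1 v t" for P env e1 e2 v t
    using that by (cases ws) (simp_all add: rows_simps branchto_within_Node)
  define a where "a = length ws + 1"
  have first: "callto_within prog first_fn [bits X ws, Leaf] (bits (first_in X ws) ws) (20 * a)"
    using callto_first[OF assms, of X False] by (simp add: enc_bool_simps a_def)
  have iterate: "callto_within prog iterate_fn [rows N ws ws, rows N ws ws, bits X ws, bits Y ws]
      (bits ((grow N ws X ^^ length ws) Y) ws) (80 * a ^ 3)" for Y
    using callto_iterate[of "map (\<lambda>v. bits (N v) ws) ws" N ws X Y,
        folded rows_def, unfolded length_map, folded a_def]
    by (simp add: power2_eq_square power3_eq_cube mult.assoc)
  have check: "callto_within prog check_fn [rows N ws ws, bits X ws, bits Y ws, bits X ws]
      (enc_bool (\<forall>v\<in>set ws. if v \<in> X then v \<in> Y else N v \<inter> X \<inter> set ws \<noteq> {})) (40 * a\<^sup>2)" for Y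
    using callto_check[of N ws ws X Y, folded a_def] by (simp add: power2_eq_square mult.assoc)
  have "1 \<le> a ^ 3" "a \<le> a ^ 3" "a\<^sup>2 \<le> a ^ 3"
    using power_increasing[of 1 3 a] power_increasing[of 2 3 a] by (simp_all add: a_def)
  then show ?thesis
    unfolding a_def[symmetric]
    by - (rule callto_within_progI, unfold cds_body_def,
      (rule evalto_within_rules branch first iterate check)+,
      use False in \<open>simp_all add: cds_test_def\<close>)
qed

subsection \<open>Running time of the minimality test\<close>

lemma callto_extension:
  assumes "distinct ws"
  shows "callto_within prog extension_fn [rows N ws ws, bits A ws, bits S ws]
    (enc_bool (cds_test N ws (A \<union> S))) (250 * (length ws + 1) ^ 3)"
proof -
  define a where "a = length ws + 1"
  have "1 \<le> a" "a \<le> a ^ 3"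
    using power_increasing[of 1 3 a] by (simp_all add: a_def)
  then show ?thesis
    unfolding a_def[symmetric]
    by - (rule callto_within_progI, unfold extension_body_def,
      (rule evalto_within_rules callto_union[of _ ws, folded a_def]
        callto_cds[OF assms, folded a_def])+, simp_all)
qed

lemma callto_prefix:
  "callto_within prog prefix_fn [b, enc_list xs, a]
    (foldr Node (map (Node b) xs) a) (20 * (length xs + 1))"
proof (induction xs)
  case Nil
  show ?case
    by (rule callto_within_progI, unfold prefix_body_def enc_list.simps,
      (rule evalto_within_rules)+) auto
next
  case (Cons x xs)
  show ?case
    by (rule callto_within_progI, unfold prefix_body_def enc_list.simps,
      (rule evalto_within_rules Cons.IH)+) auto
qed

lemma map_bits_deletions_Cons:
  assumes "distinct (v # vs)"
  shows "map (\<lambda>u. bits (S - {u}) (v # vs)) (filter (\<lambda>u. u \<in> S) (v # vs)) =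
    (if v \<in> S then [Node Leaf (bits S vs)] else []) @
    map (Node (enc_bool (v \<in> S))) (map (\<lambda>u. bits (S - {u}) vs) (filter (\<lambda>u. u \<in> S) vs))"
proof -
  have "bits (S - {v}) vs = bits S vs" using assms by (auto intro: bits_cong)
  moreover have "v \<noteq> u" if "u \<in> set vs" for u using assms that by auto
  ultimately show ?thesis by (simp add: bits_simps enc_bool_simps)
qed

lemma callto_deletions:
  assumes "distinct vs"
  shows "callto_within prog deletions_fn [bits S vs]
    (enc_list (map (\<lambda>u. bits (S - {u}) vs) (filter (\<lambda>u. u \<in> S) vs))) (40 * (length vs + 1)\<^sup>2)"
  using assms
proof (induction vs)
  case Nil
  show ?case
    by (rule callto_within_progI, unfold deletions_body_def bits_simps,
      (rule evalto_within_rules)+) auto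
next
  case (Cons v vs)
  then have IH: "callto_within prog deletions_fn [bits S vs]
      (enc_list (map (\<lambda>u. bits (S - {u}) vs) (filter (\<lambda>u. u \<in> S) vs))) (40 * (length vs + 1)\<^sup>2)"
    by simp
  define us where "us = filter (\<lambda>u. u \<in> S) vs"
  have "length us \<le> length vs" by (simp add: us_def)
  then show ?case
    unfolding map_bits_deletions_Cons[OF Cons.prems, of S, folded us_def]
    by - (rule callto_within_progI, unfold deletions_body_def bits_simps,
      (rule evalto_within_rules IH[folded us_def] callto_prefix)+,
      auto simp: foldr_Node_Leaf enc_bool_simps power2_eq_square)
qed

lemma callto_none:
  assumes "distinct ws"
  shows "callto_within prog none_fn [enc_list (map (\<lambda>S. bits S ws) Ss), rows N ws ws, bits A ws]
    (enc_bool (\<forall>S\<in>set Ss. \<not> cds_test N ws (A \<union> S))) (300 * (length ws + 1) ^ 3 * (length Ss + 1))"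
proof -
  define c where "c = (length ws + 1) ^ 3"
  have "1 \<le> c" by (simp add: c_def)
  then show ?thesis
    unfolding c_def[symmetric]
  proof (induction Ss)
    case Nil
    then show ?case
      by - (rule callto_within_progI, unfold none_body_def enc_list.simps list.map,
        (rule evalto_within_rules)+, auto simp: enc_bool_simps)
  next
    case (Cons S Ss)
    note IH = Cons.IH[OF Cons.prems]
    show ?case
      by (rule callto_within_progI, unfold none_body_def enc_list.simps list.map,
        (rule evalto_within_rules IH callto_extension[OF assms, folded c_def])+)
        (use Cons.prems in \<open>auto simp: enc_bool_simps\<close>)
  qed
qed

definition minimal_test :: "('a \<Rightarrow> 'a set) \<Rightarrow> 'a list \<Rightarrow> 'a set \<Rightarrow> 'a set \<Rightarrow> bool" where
  "minimal_test N ws A S \<longleftrightarrow> cds_test N ws (A \<union> S) \<and>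
    (\<forall>v\<in>S \<inter> set ws. \<not> cds_test N ws (A \<union> (S - {v})))"

lemma callto_minimal:
  assumes "distinct ws"
  shows "callto_within prog minimal_fn [rows N ws ws, bits A ws, bits S ws]
    (enc_bool (minimal_test N ws A S)) (700 * (length ws + 1) ^ 4)"
proof -
  define a where "a = length ws + 1"
  define us where "us = filter (\<lambda>u. u \<in> S) ws"
  have "300 * a ^ 3 * (length us + 1) \<le> 300 * a ^ 3 * a"
    by (rule mult_le_mono2) (simp add: us_def a_def)
  also have "\<dots> = 300 * a ^ 4"
    using power_add[of a 3 1] by simp
  finally have time: "300 * a ^ 3 * (length us + 1) \<le> 300 * a ^ 4" .
  have none: "callto_within prog none_fn
      [enc_list (map (\<lambda>u. bits (S - {u}) ws) us), rows N ws ws, bits A ws]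
      (enc_bool (\<forall>S'\<in>set (map (\<lambda>u. S - {u}) us). \<not> cds_test N ws (A \<union> S'))) (300 * a ^ 4)"
    by (rule callto_within_mono[OF callto_none[OF assms, of "map (\<lambda>u. S - {u}) us" N A,
            folded a_def, unfolded length_map map_map comp_def] time])
  have "1 \<le> a ^ 4" "a\<^sup>2 \<le> a ^ 4" "a ^ 3 \<le> a ^ 4"
    using power_increasing[of 2 4 a] power_increasing[of 3 4 a] by (simp_all add: a_def)
  then show ?thesis
    unfolding a_def[symmetric]
    by - (rule callto_within_progI, unfold minimal_body_def,
      (rule evalto_within_rules callto_extension[OF assms, folded a_def]
        callto_deletions[OF assms, of S, folded a_def us_def] none)+,
      auto simp: minimal_test_def us_def enc_bool_def)
qed

lemma callto_filter:
  assumes "distinct ws"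
  shows "callto_within prog filter_fn [enc_list (map (\<lambda>S. bits S ws) Ss), rows N ws ws, bits A ws]
    (enc_list (map (\<lambda>S. bits S ws) (filter (minimal_test N ws A) Ss)))
    (800 * (length ws + 1) ^ 4 * (length Ss + 1))"
proof -
  define c where "c = (length ws + 1) ^ 4"
  have "1 \<le> c" by (simp add: c_def)
  then show ?thesis
    unfolding c_def[symmetric]
  proof (induction Ss)
    case Nil
    then show ?case
      by - (rule callto_within_progI, unfold filter_body_def enc_list.simps list.map,
        (rule evalto_within_rules)+, auto)
  next
    case (Cons S Ss)
    note IH = Cons.IH[OF Cons.prems]
    show ?case
      by (rule callto_within_progI, unfold filter_body_def enc_list.simps list.map,
        (rule evalto_within_rules IH callto_minimal[OF assms, folded c_def])+)
        (use Cons.prems in auto)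
  qed
qed

subsection \<open>Running time of the enumeration\<close>

fun bounded_subsets :: "'a set \<Rightarrow> 'a list \<Rightarrow> nat \<Rightarrow> 'a set list" where
  "bounded_subsets L [] k = [{}]"
| "bounded_subsets L (v # vs) k = bounded_subsets L vs k @
     (if v \<in> L \<and> k > 0 then map (insert v) (bounded_subsets L vs (k - 1)) else [])"

lemma length_bounded_subsets_pos: "1 \<le> length (bounded_subsets L vs k)"
  by (induction vs arbitrary: k) (auto intro: trans_le_add1)

lemma small_subsets_insert:
  assumes "finite A" "a \<notin> A"
  shows "{S. S \<subseteq> insert a A \<and> card S \<le> k} = {S. S \<subseteq> A \<and> card S \<le> k} \<union>
    (if k > 0 then insert a ` {S. S \<subseteq> A \<and> card S \<le> k - 1} else {})"
    (is "?lhs = ?without \<union> ?containing")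
proof (intro set_eqI iffI)
  fix S assume S: "S \<in> ?lhs"
  show "S \<in> ?without \<union> ?containing"
  proof (cases "a \<in> S")
    case True
    then obtain T where T: "S = insert a T" "a \<notin> T" by (rule Set.set_insert)
    then have "T \<subseteq> A" "finite T" using S assms(1) finite_subset by auto
    then show ?thesis using S T by auto
  next
    case False
    then show ?thesis using S by auto
  qed
next
  fix S assume "S \<in> ?without \<union> ?containing"
  then consider (without) "S \<subseteq> A" "card S \<le> k" |
    (containing) T where "k > 0" "S = insert a T" "T \<subseteq> A" "card T \<le> k - 1"
    by (auto split: if_splits)
  then show "S \<in> ?lhs"
  proof cases
    case containing
    then have "finite T" "a \<notin> T" using assms finite_subset by auto
    then show ?thesis using containing by auto
  qed auto
qed

lemma set_bounded_subsets:
  "distinct vs \<Longrightarrow> set (bounded_subsets L vs k) = {S. S \<subseteq> L \<inter> set vs \<and> card S \<le> k}"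
proof (induction vs arbitrary: k)
  case (Cons v vs)
  then have IH: "set (bounded_subsets L vs k) = {S. S \<subseteq> L \<inter> set vs \<and> card S \<le> k}"
    and v: "v \<notin> L \<inter> set vs" for k
    by simp_all
  show ?case
  proof (cases "v \<in> L")
    case True
    then have "L \<inter> set (v # vs) = insert v (L \<inter> set vs)" by auto
    then show ?thesis using True v by (simp add: IH small_subsets_insert del: Int_insert_right)
  next
    case False
    then show ?thesis by (simp add: IH)
  qed
qed auto

lemma distinct_bounded_subsets: "distinct vs \<Longrightarrow> distinct (bounded_subsets L vs k)"
proof (induction vs arbitrary: k)
  case (Cons v vs)
  have "inj_on (insert v) {S. v \<notin> S}" by (auto simp: inj_on_def)
  then have "inj_on (insert v) (set (bounded_subsets L vs (k - 1)))"
    by (rule inj_on_subset) (use Cons.prems in \<open>auto simp: set_bounded_subsets\<close>)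
  then show ?case
    using Cons by (auto simp: distinct_map set_bounded_subsets)
qed simp

lemma length_bounded_subsets:
  assumes "distinct vs"
  shows "length (bounded_subsets L vs k) = card {S. S \<subseteq> L \<inter> set vs \<and> card S \<le> k}"
  using distinct_card[OF distinct_bounded_subsets[OF assms]] set_bounded_subsets[OF assms] by metis

lemma map_bits_bounded_subsets_Cons:
  assumes "distinct (v # vs)"
  shows "map (\<lambda>S. bits S (v # vs)) (bounded_subsets L (v # vs) k) =
    map (Node Leaf) (map (\<lambda>S. bits S vs) (bounded_subsets L vs k)) @
    (if v \<in> L \<and> k > 0 then
       map (Node (Node Leaf Leaf)) (map (\<lambda>S. bits S vs) (bounded_subsets L vs (k - 1))) else [])"
proof -
  have subset: "S \<subseteq> set vs" if "S \<in> set (bounded_subsets L vs k)" for S k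
    using that assms by (auto simp: set_bounded_subsets)
  have "bits S (v # vs) = Node Leaf (bits S vs)" if "S \<in> set (bounded_subsets L vs k)" for S
  proof -
    have "v \<notin> S" using subset[OF that] assms by auto
    then show ?thesis by (simp add: bits_simps enc_bool_simps)
  qed
  moreover have "bits (insert v S) (v # vs) = Node (Node Leaf Leaf) (bits S vs)" for S
    using assms by (auto simp: bits_simps enc_bool_simps intro: bits_cong)
  ultimately show ?thesis by simp
qed

lemma callto_subsets:
  assumes "distinct vs"
  shows "callto_within prog subsets_fn [bits L vs, unary k]
    (enc_list (map (\<lambda>S. bits S vs) (bounded_subsets L vs k)))
    (100 * (length vs + 1) * length (bounded_subsets L vs k))"
  using assms
proof (induction vs arbitrary: k)
  case Nil
  show ?case
    by (rule callto_within_progI, unfold subsets_body_def bits_simps, (rule evalto_within_rules)+)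
      (auto simp: bits_simps)
next
  case (Cons v vs)
  then have IH: "callto_within prog subsets_fn [bits L vs, unary k]
      (enc_list (map (\<lambda>S. bits S vs) (bounded_subsets L vs k)))
      (100 * (length vs + 1) * length (bounded_subsets L vs k))" for k
    by simp
  note foldr_Node = foldr_Node_Leaf foldr_Node_enc_list
  show ?case
  proof (cases k)
    case 0
    show ?thesis
      unfolding 0 map_bits_bounded_subsets_Cons[OF Cons.prems]
      by (rule callto_within_progI, unfold subsets_body_def bits_simps unary_simps,
          (rule evalto_within_rules IH[of 0, unfolded unary_simps] callto_prefix)+)
        (use length_bounded_subsets_pos[of L vs 0] in \<open>auto simp: foldr_Node algebra_simps\<close>)
  next
    case (Suc j)
    show ?thesis
      unfolding Suc map_bits_bounded_subsets_Cons[OF Cons.prems]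
      by (rule callto_within_progI, unfold subsets_body_def bits_simps unary_simps,
          (rule evalto_within_rules IH[of j] IH[of "Suc j", unfolded unary_simps] callto_prefix)+)
        (use length_bounded_subsets_pos[of L vs j] length_bounded_subsets_pos[of L vs "Suc j"]
          in \<open>auto simp: foldr_Node algebra_simps\<close>)
  qed
qed

lemma callto_budget:
  "callto_within prog budget_fn [bits L vs]
    (unary (Suc (length (filter (\<lambda>v. v \<notin> L) vs)))) (20 * (length vs + 1))"
proof (induction vs)
  case Nil
  show ?case
    by (rule callto_within_progI, unfold budget_body_def bits_simps, (rule evalto_within_rules)+)
      (auto simp: unary_simps)
next
  case (Cons v vs)
  show ?case
    by (rule callto_within_progI, unfold budget_body_def bits_simps,
      (rule evalto_within_rules Cons.IH)+) (auto simp: unary_simps)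
qed

lemma callto_main:
  fixes L :: "'a set"
  assumes "distinct ws"
  defines "Ss \<equiv> bounded_subsets L ws (Suc (length (filter (\<lambda>v. v \<notin> L) ws)))"
  shows "callto_within prog main_fn [enc_list [rows N ws ws, bits L ws, h, r, bits A ws, out]]
    (enc_list (map (\<lambda>S. bits S ws) (filter (minimal_test N ws A) Ss)))
    (3000 * (length ws + 1) ^ 4 * length Ss)"
proof -
  define a where "a = length ws + 1"
  have bounds: "1 \<le> a" "a \<le> a ^ 4" "1 \<le> length Ss"
    using power_increasing[of 1 4 a] length_bounded_subsets_pos by (simp_all add: a_def Ss_def)
  have "100 * a * length Ss \<le> 100 * (a ^ 4 * length Ss)"
    using mult_le_mono1[OF bounds(2), of "100 * length Ss"] by (simp add: ac_simps)
  then have subsets: "callto_within prog subsets_fn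
      [bits L ws, unary (Suc (length (filter (\<lambda>v. v \<notin> L) ws)))]
      (enc_list (map (\<lambda>S. bits S ws) Ss)) (100 * (a ^ 4 * length Ss))"
    using callto_subsets[OF assms(1)] callto_within_mono unfolding Ss_def a_def by blast
  have "a ^ 4 \<le> a ^ 4 * length Ss"
    using bounds(3) by simp
  then show ?thesis
    using bounds unfolding a_def[symmetric]
    by - (rule callto_within_progI, unfold main_body_def enc_list.simps,
      (rule evalto_within_rules callto_budget[of _ ws, folded a_def] subsets
        callto_filter[OF assms(1), folded a_def])+,
      rule refl, unfold distrib_left mult.assoc, linarith)
qed


subsection \<open>Correctness of the tests\<close>

lemma inflationary_funpow_stable:
  assumes inflationary: "\<And>Z. Z \<subseteq> f Z" and bounded: "\<And>i. (f ^^ i) Y \<subseteq> S" "finite S"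
  shows "f ((f ^^ card S) Y) = (f ^^ card S) Y"
proof -
  have "range (\<lambda>i. (f ^^ i) Y) \<subseteq> Pow S" using bounded(1) by auto
  then have "finite (range (\<lambda>i. (f ^^ i) Y))" using bounded(2) finite_subset by blast
  moreover have "mono (\<lambda>i. (f ^^ i) Y)" using inflationary by (simp add: mono_iff_le_Suc)
  ultimately have "(f ^^ card S) Y = (\<Union>i. (f ^^ i) Y)"
    using bounded
    by (intro finite_mono_strict_prefix_implies_finite_fixpoint
        finite_mono_remains_stable_implies_strict_prefix) auto
  moreover have "f ((f ^^ card S) Y) \<subseteq> (\<Union>i. (f ^^ i) Y)"
    using UN_upper[of "Suc (card S)" UNIV "\<lambda>i. (f ^^ i) Y"] by simp
  ultimately have "f ((f ^^ card S) Y) \<subseteq> (f ^^ card S) Y" by simp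
  then show ?thesis using inflationary by (rule antisym)
qed

context pair_graph
begin

lemma induces_connected_grow:
  "induces_connected Z \<Longrightarrow> induces_connected (grow (neighbors G) ws X Z)"
  by (rule induces_connected_superset) (auto simp: grow_def neighbors_def)

lemma induces_connected_iff_grow_stable:
  assumes X: "X \<subseteq> set ws" and Y: "Y \<subseteq> X" "induces_connected Y"
    and stable: "grow (neighbors G) ws X Y = Y"
  shows "induces_connected X \<longleftrightarrow> X = Y"
proof
  assume connected_X: "induces_connected X"
  show "X = Y"
  proof (rule ccontr)
    assume "X \<noteq> Y"
    moreover have "Y \<noteq> {}" using Y(2) by (simp add: induces_connected_iff_crossing_arc)
    ultimately obtain u v where "u \<in> Y" "v \<in> X - Y" "(u, v) \<in> parcs G"
      using induces_connected_crossing_arc[OF connected_X _ Y(1)] by blast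
    then have "v \<in> grow (neighbors G) ws X Y"
      using X Y(1) by (auto simp: grow_def neighbors_def dest: arcs_symmetric)
    then show False using stable \<open>v \<in> X - Y\<close> by simp
  qed
qed (use Y(2) in simp)

lemma induces_connected_iff_grow_funpow:
  assumes "x \<in> X" "X \<subseteq> set ws" "distinct ws"
  shows "induces_connected X \<longleftrightarrow> X \<subseteq> (grow (neighbors G) ws X ^^ length ws) {x}"
proof -
  let ?f = "grow (neighbors G) ws X"
  have invariant: "(?f ^^ i) {x} \<subseteq> X \<and> induces_connected ((?f ^^ i) {x})"
    for i
  proof (induction i)
    case 0
    then show ?case using assms(1) by (simp add: induces_connected_singleton)
  next
    case (Suc i)
    then show ?case using induces_connected_grow by (auto simp: grow_def)
  qed
  have "?f ((?f ^^ card (set ws)) {x}) = (?f ^^ card (set ws)) {x}"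
  proof (rule inflationary_funpow_stable)
    show "(?f ^^ i) {x} \<subseteq> set ws" for i using invariant assms(2) by blast
  qed (auto simp: grow_def)
  then have "induces_connected X \<longleftrightarrow> X = (?f ^^ length ws) {x}"
    using invariant[of "length ws"] assms
    by (intro induces_connected_iff_grow_stable) (simp_all add: distinct_card)
  then show ?thesis using invariant[of "length ws"] by blast
qed

lemma cds_test_iff:
  assumes ws: "distinct ws" "set ws = pverts G" and X: "X \<subseteq> pverts G"
  shows "cds_test (neighbors G) ws X \<longleftrightarrow> connected_dominating_set G X"
proof (cases "X = {}")
  case True
  then show ?thesis
    using ws(2) by (auto simp: cds_test_def connected_dominating_set_def
        induces_connected_iff_crossing_arc neq_Nil_conv)
next
  case False
  then obtain x where x: "x \<in> X" "first_in X ws = {x}"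
    using X ws(2) by (metis first_in_eq_singleton inf.absorb1)
  have "neighbors G v \<inter> X \<inter> set ws = neighbors G v \<inter> X" for v using X ws(2) by auto
  moreover have "ws \<noteq> []" using False X ws(2) by auto
  ultimately have "cds_test (neighbors G) ws X \<longleftrightarrow>
    X \<subseteq> (grow (neighbors G) ws X ^^ length ws) {x} \<and>
    (\<forall>v\<in>pverts G - X. neighbors G v \<inter> X \<noteq> {})"
    using X ws(2) x(2) by (auto simp: cds_test_def)
  then show ?thesis
    using induces_connected_iff_grow_funpow[OF x(1) _ ws(1)] X ws(2)
    by (auto simp: connected_dominating_set_def)
qed

end

lemma mult_Suc_power_le_max_2_power:
  fixes c n :: nat
  assumes "c \<le> 2 ^ m"
  shows "c * (n + 1) ^ d \<le> max 2 n ^ (m + 2 * d)"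
proof -
  have "n + 1 \<le> 2 * max 2 n" by simp
  also have "\<dots> \<le> (max 2 n)\<^sup>2" unfolding power2_eq_square by (rule mult_le_mono1) simp
  finally have "(n + 1) ^ d \<le> ((max 2 n)\<^sup>2) ^ d" by (rule power_mono) simp
  moreover have "c \<le> max 2 n ^ m" using assms power_mono[of 2 "max 2 n" m] by simp
  ultimately show ?thesis by (simp add: power_add power_mult mult_le_mono)
qed

context bipartite_extension
begin

lemma minimal_test_iff:
  assumes ws: "distinct ws" "set ws = pverts G" and S: "S \<subseteq> L"
  shows "minimal_test (neighbors G) ws In S \<longleftrightarrow> minimal_extension G In Out S"
proof -
  have "cds_test (neighbors G) ws (In \<union> T) \<longleftrightarrow> extension G In Out T" if "T \<subseteq> L" for T
  proof -
    have "In \<union> T \<subseteq> pverts G" "T \<subseteq> pverts G" "T \<inter> (In \<union> Out) = {}"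
      using that pverts_eq disjoint by auto
    then show ?thesis using cds_test_iff[OF ws] by (simp add: extension_def)
  qed
  moreover have "S \<inter> set ws = S" "S - {v} \<subseteq> L" for v
    using S ws(2) pverts_eq by auto
  ultimately show ?thesis
    using S by (simp add: minimal_test_def minimal_extension_iff_delete)
qed

lemma length_filter_notin_L:
  assumes "distinct ws" "set ws = pverts G"
  shows "length (filter (\<lambda>v. v \<notin> L) ws) = card (In \<union> Out)"
proof -
  have "{v. v \<notin> L} \<inter> set ws = In \<union> Out" using assms(2) pverts_eq disjoint by auto
  then show ?thesis by (simp add: distinct_length_filter[OF assms(1)])
qed

lemma set_filter_minimal_test:
  assumes ws: "distinct ws" "set ws = pverts G"
  shows "set (filter (minimal_test (neighbors G) ws In)
      (bounded_subsets L ws (Suc (card (In \<union> Out))))) = {S. minimal_extension G In Out S}"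
proof -
  have "L \<inter> set ws = L" using ws(2) pverts_eq by auto
  moreover have "S \<subseteq> L" "card S \<le> Suc (card (In \<union> Out))" if "minimal_extension G In Out S" for S
    using that card_minimal_extension_le[OF that] extension_subset
    by (auto simp: minimal_extension_def)
  ultimately show ?thesis
    using minimal_test_iff[OF ws] by (auto simp: set_bounded_subsets[OF ws(1)])
qed

lemma length_bounded_subsets_le:
  assumes ws: "distinct ws" and few: "10 * card (In \<union> Out) \<le> 3 * card L"
  shows "real (length (bounded_subsets L ws (Suc (card (In \<union> Out)))))
    \<le> 2 * 2 powr (9 / 10 * real (card L))"
proof -
  have "length (bounded_subsets L ws (Suc (card (In \<union> Out))))
    \<le> card {S. S \<subseteq> L \<and> card S \<le> Suc (card (In \<union> Out))}"
    unfolding length_bounded_subsets[OF ws] using finite_sides(1) by (intro card_mono) auto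
  then have "real (length (bounded_subsets L ws (Suc (card (In \<union> Out)))))
    \<le> 2 ^ Suc (card (In \<union> Out)) * (3 / 2) ^ card L"
    using card_small_subsets_le[OF finite_sides(1)] of_nat_mono order_trans by blast
  also have "\<dots> \<le> 2 * 2 powr (9 / 10 * real (card L))"
    using two_power_times_three_halves_power_le[OF few] by simp
  finally show ?thesis .
qed

lemma enumeration_time_le:
  assumes ws: "distinct ws" and few: "10 * card (In \<union> Out) \<le> 3 * card L"
    and t: "t \<le> 3000 * (n + 1) ^ 4 * length (bounded_subsets L ws (Suc (card (In \<union> Out)))) + 2"
  shows "real t \<le> 2 powr (9 / 10 * real (card L)) * real (max 2 n) ^ 21"
proof -
  define m where "m = length (bounded_subsets L ws (Suc (card (In \<union> Out))))"
  have "1 \<le> (n + 1) ^ 4 * m"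
    using length_bounded_subsets_pos[of L ws] by (simp add: m_def)
  then have "t \<le> 4096 * ((n + 1) ^ 4 * m)"
    using t unfolding m_def[symmetric] mult.assoc by linarith
  then have "real t \<le> real (4096 * ((n + 1) ^ 4 * m))" by (rule of_nat_mono)
  also have "\<dots> = real (4096 * (n + 1) ^ 4) * real m" by simp
  also have "\<dots> \<le> real (4096 * (n + 1) ^ 4) * (2 * 2 powr (9 / 10 * real (card L)))"
    unfolding m_def by (intro mult_left_mono length_bounded_subsets_le[OF ws few]) simp
  also have "\<dots> = 2 powr (9 / 10 * real (card L)) * real (8192 * (n + 1) ^ 4)"
    by simp
  also have "\<dots> \<le> 2 powr (9 / 10 * real (card L)) * real (max 2 n ^ 21)"
    using mult_Suc_power_le_max_2_power[of 8192 13 n 4]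
    by (intro mult_left_mono of_nat_mono) simp_all
  finally show ?thesis by simp
qed

end

lemma enc_set_eq_bits: "enc_set n X = bits X [0..<n]"
  by (simp add: enc_set_def bits_def)

lemma enc_instance_eq:
  "enc_instance n G L H R In Out = enc_list [rows (neighbors G) [0..<n] [0..<n],
    bits L [0..<n], bits H [0..<n], bits R [0..<n], bits In [0..<n], bits Out [0..<n]]"
  by (simp add: enc_instance_def enc_graph_def rows_def enc_set_eq_bits)

lemma prog_enumerates_minimal_extensions:
  assumes G: "bipartite_extension G L In Out" "pverts G = {0..<n}"
    and few: "10 * card (In \<union> Out) \<le> 3 * card L"
  obtains t where
    "enumerates_in_time prog n (enc_instance n G L H R In Out) {S. minimal_extension G In Out S} t"
    "real t \<le> 2 powr (9 / 10 * real (card L)) * real (max 2 n) ^ 21"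
proof -
  interpret bipartite_extension G L In Out by (rule G(1))
  define ws where "ws = [0..<n]"
  have ws: "distinct ws" "set ws = pverts G" "length ws = n" by (simp_all add: ws_def G(2))
  define Ss where "Ss = bounded_subsets L ws (Suc (card (In \<union> Out)))"
  have "callto_within prog main_fn [enc_instance n G L H R In Out]
      (enc_list (map (enc_set n) (filter (minimal_test (neighbors G) ws In) Ss)))
      (3000 * (n + 1) ^ 4 * length Ss)"
    using callto_main[OF ws(1), of "neighbors G" L "bits H ws" "bits R ws" In "bits Out ws"]
    by (simp add: enc_instance_eq enc_set_eq_bits[abs_def] length_filter_notin_L[OF ws(1,2)]
        ws(3) Ss_def flip: ws_def)
  then obtain t where t: "t \<le> 3000 * (n + 1) ^ 4 * length Ss + 2"
    "computes_in_time prog (enc_instance n G L H R In Out)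
      (enc_list (map (enc_set n) (filter (minimal_test (neighbors G) ws In) Ss))) t"
    by (rule computes_in_time_if_callto_within)
  show thesis
  proof
    show "enumerates_in_time prog n (enc_instance n G L H R In Out)
        {S. minimal_extension G In Out S} t"
      unfolding enumerates_in_time_def
      using t(2) set_filter_minimal_test[OF ws(1,2)] distinct_bounded_subsets[OF ws(1)]
      by (metis Ss_def distinct_filter)
    show "real t \<le> 2 powr (9 / 10 * real (card L)) * real (max 2 n) ^ 21"
      using t(1) by (intro enumeration_time_le[OF ws(1) few]) (simp add: Ss_def)
  qed
qed

lemma two_powr_nine_tenths:
  "2 powr real m * 2 powr (- (real m / 10)) = 2 powr (9 / 10 * real m)"
  by (simp flip: powr_add)

theorem lemma15:
  shows
    "(\<forall>(l::nat) (G::'a pair_pre_digraph) L H R In Out.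
        l \<ge> 1 \<and> pair_graph G \<and> excellent_partition l G L H R \<and>
        In \<union> Out = H \<union> R \<and> In \<inter> Out = {} \<and>
        real (card {v \<in> R. degree G v < 10 * l}) \<le> real (card L) / 10
        \<longrightarrow> real (card {S. minimal_extension G In Out S})
              \<le> 2 powr real (card L) * 2 powr (- (real (card L) / 10)))
     \<and>
     (\<exists>(P::program) (c::nat).
        \<forall>(l::nat) (n::nat) (G::nat pair_pre_digraph) L H R In Out.
          l \<ge> 1 \<and> pair_graph G \<and> pverts G = {0..<n} \<and> excellent_partition l G L H R \<and>
          In \<union> Out = H \<union> R \<and> In \<inter> Out = {} \<and>
          real (card {v \<in> R. degree G v < 10 * l}) \<le> real (card L) / 10
          \<longrightarrow> (\<exists>t. enumerates_in_time P n (enc_instance n G L H R In Out)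
                        {S. minimal_extension G In Out S} t \<and>
                   real t \<le> 2 powr real (card L) * 2 powr (- (real (card L) / 10))
                              * real (max 2 n) ^ c))"
  unfolding two_powr_nine_tenths
proof (rule conjI[OF _ exI[of _ prog, OF exI[of _ 21]]]; intro allI impI; elim conjE)
  fix l :: nat and G :: "'a pair_pre_digraph" and L H R In Out
  assume "l \<ge> 1" and G: "pair_graph G" "excellent_partition l G L H R"
    and In_Out: "In \<union> Out = H \<union> R" "In \<inter> Out = {}"
    and "real (card {v \<in> R. degree G v < 10 * l}) \<le> real (card L) / 10"
  then have "10 * card (In \<union> Out) \<le> 3 * card L"
    by (simp add: pair_graph.card_excellent_partition_le)
  then show "real (card {S. minimal_extension G In Out S}) \<le> 2 powr (9 / 10 * real (card L))"
    by (rule bipartite_extension.card_minimal_extensions_le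
        [OF excellent_partition_bipartite_extension[OF G In_Out]])
next
  fix l n :: nat and G :: "nat pair_pre_digraph" and L H R In Out
  assume "l \<ge> 1" and G: "pair_graph G" "excellent_partition l G L H R" and "pverts G = {0..<n}"
    and In_Out: "In \<union> Out = H \<union> R" "In \<inter> Out = {}"
    and "real (card {v \<in> R. degree G v < 10 * l}) \<le> real (card L) / 10"
  then have "10 * card (In \<union> Out) \<le> 3 * card L"
    by (simp add: pair_graph.card_excellent_partition_le)
  with \<open>pverts G = {0..<n}\<close>
  show "\<exists>t. enumerates_in_time prog n (enc_instance n G L H R In Out)
        {S. minimal_extension G In Out S} t \<and>
      real t \<le> 2 powr (9 / 10 * real (card L)) * real (max 2 n) ^ 21"
    by (rule prog_enumerates_minimal_extensions
        [OF excellent_partition_bipartite_extension[OF G In_Out]]) blast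
qed

end
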